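(* Let $d,r,s\geq1$ and let $\mu=(\underbrace{d,\dotsc,d}_{r},\underbrace{1,\dotsc,1}_{s})$ (so $\ell=r+s-1$). Then \[ B_{\mu,d}(x,t)=x+x^s\,\frac{\bigl(1+tx^r(1+x+\cdots+x^{s-1})\bigr)^d-1}{1+x+\cdots+x^{s-1}}. \]
   Context: For a partition $\mu=(\mu_0\geq\cdots\geq\mu_\ell\geq1)$ and $d\geq1$: an anchor word of length $n$ is a word $a_1\cdots a_n$ over $\{1,\dotsc,d,\infty\}$ such that $a_i\neq\infty$ implies $a_{i+k}\geq a_i+\mu_k$ for $k=1,\dotsc,\ell$ ($\infty$ larger than every integer) and $a_{n-\ell+1}=\cdots=a_n=\infty$. A fault-free anchor word is either $(\infty)$ or a word starting with an integer, ending with $\ell$ consecutive $\infty$'s, with that final block the only occurrence of $\ell$ consecutive $\infty$'s. $B_{\mu,d}(x,t)=\sum x^{\mathrm{width}(w)}t^{\mathrm{bigtiles}(w)}$ over fault-free anchor words $w$, where width is the length and bigtiles the number of non-$\infty$ letters. *)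

theory Defs
  imports
    "HOL-Library.Extended_Nat"
    "HOL-Computational_Algebra.Formal_Power_Series"
begin

text \<open>
  A partition \<open>\<mu> = (\<mu>\<^sub>0 \<ge> \<dots> \<ge> \<mu>\<^sub>\<ell> \<ge> 1)\<close> is the list of its parts, so that \<open>\<mu> ! k\<close> is \<open>\<mu>\<^sub>k\<close>.
  Words are lists over \<^typ>\<open>enat\<close>, with positions counted from \<open>0\<close>.
\<close>

definition last_index :: "nat list \<Rightarrow> nat"  ("\<ell>") where
  "\<ell> \<mu> = length \<mu> - 1"

text \<open>
  The last \<open>\<ell>\<close> letters are \<open>\<infinity>\<close>; in a word with fewer than \<open>\<ell>\<close> letters this means all of them.
  Hence an integer letter at position \<open>i\<close> forces \<open>i + \<ell> \<mu> < length w\<close>, and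
  all accesses \<open>w ! (i + k)\<close> below are within the word.
\<close>

definition anchor_word :: "nat list \<Rightarrow> nat \<Rightarrow> enat list \<Rightarrow> bool" where
  "anchor_word \<mu> d w \<longleftrightarrow>
     set w \<subseteq> insert \<infinity> (enat ` {1..d}) \<and>
     (\<forall>i < length w. w ! i \<noteq> \<infinity> \<longrightarrow>
        (\<forall>k \<in> {1..\<ell> \<mu>}. w ! (i + k) \<ge> w ! i + enat (\<mu> ! k))) \<and>
     (\<forall>i < length w. length w \<le> i + \<ell> \<mu> \<longrightarrow> w ! i = \<infinity>)"

definition infinity_block :: "nat \<Rightarrow> enat list \<Rightarrow> nat \<Rightarrow> bool" where
  "infinity_block m w j \<longleftrightarrow> j + m \<le> length w \<and> (\<forall>i < m. w ! (j + i) = \<infinity>)"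

text \<open>
  The second alternative says that \<open>w\<close> starts with an integer and that the only (possibly
  overlapping) occurrence of \<open>\<ell>\<close> consecutive letters \<open>\<infinity>\<close> is the one at the very end.
\<close>

definition fault_free :: "nat list \<Rightarrow> nat \<Rightarrow> enat list \<Rightarrow> bool" where
  "fault_free \<mu> d w \<longleftrightarrow> anchor_word \<mu> d w \<and>
     (w = [\<infinity>] \<or>
      w \<noteq> [] \<and> hd w \<noteq> \<infinity> \<and> \<ell> \<mu> \<le> length w \<and>
      {j. infinity_block (\<ell> \<mu>) w j} = {length w - \<ell> \<mu>})"

definition width :: "enat list \<Rightarrow> nat" where
  "width w = length w"

definition bigtiles :: "enat list \<Rightarrow> nat" where
  "bigtiles w = length (filter (\<lambda>a. a \<noteq> \<infinity>) w)"

text \<open>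
  Generating functions live in \<open>\<rat>[[t]][[x]]\<close>: the outer series variable is \<open>x\<close>, the inner one \<open>t\<close>.
  The rational coefficients provide the type class needed for division; a series in \<open>x\<close> whose
  constant coefficient is \<open>1\<close> is a unit there, so dividing by it is genuine division.
\<close>

abbreviation var_x :: "rat fps fps" where "var_x \<equiv> fps_X"

abbreviation var_t :: "rat fps fps" where "var_t \<equiv> fps_const fps_X"

text \<open>
  The sum over all fault-free words, grouped by width: there are only finitely many
  words of each width, so every coefficient is a finite sum.
\<close>

definition fault_free_gf :: "nat list \<Rightarrow> nat \<Rightarrow> rat fps fps" where
  "fault_free_gf \<mu> d = Abs_fps (\<lambda>n. \<Sum>w | fault_free \<mu> d w \<and> width w = n. fps_X ^ bigtiles w)"

lemma finite_fault_free_width: "finite {w. fault_free \<mu> d w \<and> width w = n}"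
proof (rule finite_subset)
  show "{w. fault_free \<mu> d w \<and> width w = n}
      \<subseteq> {w. set w \<subseteq> insert \<infinity> (enat ` {1..d}) \<and> length w = n}"
    by (auto simp: fault_free_def anchor_word_def width_def)
  show "finite {w. set w \<subseteq> insert \<infinity> (enat ` {1..d}) \<and> length w = n}"
    by (rule finite_lists_length_eq) simp
qed

lemma divide_mult_cancel_unit:
  fixes f g :: "rat fps fps"
  assumes "fps_nth g 0 = 1"
  shows "f / g * g = f"
proof -
  have 1: "inverse (1 :: rat fps) = 1"
    by (rule fps_inverse_one)
  have 0: "subdegree g = 0" "g \<noteq> 0"
    using assms by (auto intro: subdegreeI)
  have "g * inverse g = 1"
    using fps_right_inverse[of g 1] assms 1 by (simp add: fps_inverse_def[of g])
  then show ?thesis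
    using 0 by (simp add: fps_divide_def Let_def mult.assoc mult.commute[of _ g])
qed

end

theory Submission imports Defs begin

text \<open>
  In a fault-free word that starts with an integer, consecutive integers lie at distances between
  \<open>r\<close> and \<open>r + s - 1\<close>: the parts \<open>d\<close> forbid smaller ones, and larger ones would
  create an early block of \<open>\<ell>\<close> letters \<open>\<infinity>\<close>. At these distances the parts \<open>1\<close> only
  require the integers to increase. Let \<open>L\<^sub>c\<close> be the generating function of the words whose first
  letter is an integer greater than \<open>c\<close>, and \<open>S = 1 + x + \<dots> + x\<^sup>s\<^sup>-\<^sup>1\<close>. Splitting off the
  first letter \<open>c\<close> together with the \<open>\<infinity>\<close>s after it gives
  \<open>L\<^sub>c\<^sub>-\<^sub>1 = (1 + t x\<^sup>r S) L\<^sub>c + t x\<^sup>r\<^sup>+\<^sup>s\<close>, so \<open>S L\<^sub>c + x\<^sup>s\<close> is a geometric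
  progression in \<open>d - c\<close> with ratio \<open>1 + t x\<^sup>r S\<close>.
\<close>

section \<open>Removing and prepending an initial segment, for arbitrary partitions\<close>

lemma infinity_block_append:
  "infinity_block m (p @ w) (length p + j) \<longleftrightarrow> infinity_block m w j"
  by (auto simp: infinity_block_def add.assoc nth_append_length_plus)

text \<open>The conditions look only to the right, and a suffix has the same right end as the whole
  word.\<close>

lemma anchor_word_appendD:
  assumes "anchor_word \<mu> d (p @ w)"
  shows "anchor_word \<mu> d w"
  unfolding anchor_word_def
proof (intro conjI allI impI ballI)
  show "set w \<subseteq> insert \<infinity> (enat ` {1..d})"
    using assms by (auto simp: anchor_word_def)
next
  fix i k
  assume "i < length w" "w ! i \<noteq> \<infinity>" "k \<in> {1..\<ell> \<mu>}"
  then have "(p @ w) ! (length p + i + k) \<ge> (p @ w) ! (length p + i) + enat (\<mu> ! k)"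
    using assms unfolding anchor_word_def
    by (metis length_append nat_add_left_cancel_less nth_append_length_plus)
  then show "w ! (i + k) \<ge> w ! i + enat (\<mu> ! k)"
    by (simp add: add.assoc nth_append_length_plus)
next
  fix i
  assume "i < length w" "length w \<le> i + \<ell> \<mu>"
  then have "(p @ w) ! (length p + i) = \<infinity>"
    using assms unfolding anchor_word_def
    by (metis add.assoc length_append nat_add_left_cancel_le nat_add_left_cancel_less)
  then show "w ! i = \<infinity>"
    by (simp add: nth_append_length_plus)
qed

text \<open>Otherwise position 0 would be among the last \<open>\<ell> \<mu>\<close> positions,
  which carry \<infinity>.\<close>

lemma anchor_word_length:
  assumes "anchor_word \<mu> d w" "w \<noteq> []" "hd w \<noteq> \<infinity>"
  shows "\<ell> \<mu> < length w"
proof (rule ccontr)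
  assume "\<not> \<ell> \<mu> < length w"
  then have "w ! 0 = \<infinity>"
    using assms(1,2) by (simp add: anchor_word_def)
  then show False
    using assms(2,3) by (simp add: hd_conv_nth)
qed

text \<open>The inserted \<infinity>s impose nothing and satisfy every bound, so only the bounds
  from the new letter \<open>a\<close> into \<open>w\<close> remain. As \<open>w\<close> has more
  than \<open>\<ell> \<mu>\<close> letters, the final block stays inside \<open>w\<close>.\<close>

lemma anchor_word_Cons_replicate_append:
  assumes "w \<noteq> []" "hd w \<noteq> \<infinity>"
  shows "anchor_word \<mu> d (enat a # replicate n \<infinity> @ w) \<longleftrightarrow>
    anchor_word \<mu> d w \<and> a \<in> {1..d} \<and> (\<forall>k\<in>{Suc n..\<ell> \<mu>}. enat (a + \<mu> ! k) \<le> w ! (k - Suc n))"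
    (is "anchor_word \<mu> d ?v \<longleftrightarrow> ?R")
proof
  assume v: "anchor_word \<mu> d ?v"
  have "anchor_word \<mu> d w"
    using anchor_word_appendD[of \<mu> d "enat a # replicate n \<infinity>" w] v by simp
  moreover have "a \<in> {1..d}"
    using v by (auto simp: anchor_word_def)
  moreover have "enat (a + \<mu> ! k) \<le> w ! (k - Suc n)" if k: "k \<in> {Suc n..\<ell> \<mu>}" for k
  proof -
    have "?v ! 0 + enat (\<mu> ! k) \<le> ?v ! (0 + k)"
      using v k unfolding anchor_word_def by fastforce
    moreover have "?v ! k = w ! (k - Suc n)"
      using k by (cases k) (auto simp: nth_append)
    ultimately show ?thesis by simp
  qed
  ultimately show ?R by blast
next
  assume R: ?R
  then have w: "anchor_word \<mu> d w" by blast
  note len = anchor_word_length[OF w assms]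
  have nth0: "?v ! 0 = enat a" by simp
  have nth1: "?v ! i = \<infinity>" if "0 < i" "i \<le> n" for i
    using that by (auto simp: nth_append nth_Cons')
  have nth2: "?v ! i = w ! (i - Suc n)" if "n < i" for i
    using that by (auto simp: nth_append nth_Cons')
  show "anchor_word \<mu> d ?v"
    unfolding anchor_word_def
  proof (intro conjI allI impI ballI)
    show "set ?v \<subseteq> insert \<infinity> (enat ` {1..d})"
      using R by (auto simp: anchor_word_def)
  next
    fix i k
    assume i: "i < length ?v" "?v ! i \<noteq> \<infinity>" and k: "k \<in> {1..\<ell> \<mu>}"
    \<comment> \<open>The new letter compared with the run of \<infinity>s, the new letter compared
      with \<open>w\<close>, and comparisons inside \<open>w\<close>.\<close>
    consider "i = 0" "k \<le> n" | "i = 0" "n < k" | "n < i"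
      using i nth1 by (meson gr0I not_le)
    then show "?v ! (i + k) \<ge> ?v ! i + enat (\<mu> ! k)"
    proof cases
      case 1
      then show ?thesis using nth1[of k] k by simp
    next
      case 2
      then have "enat (a + \<mu> ! k) \<le> w ! (k - Suc n)"
        using R k by simp
      then show ?thesis
        using 2 nth0 nth2[of k] by simp
    next
      case 3
      define j where "j = i - Suc n"
      have "?v ! i = w ! j" "?v ! (i + k) = w ! (j + k)" "j < length w"
        using 3 i nth2[of i] nth2[of "i + k"] by (simp_all add: j_def)
      then show ?thesis
        using w k i(2) unfolding anchor_word_def by metis
    qed
  next
    fix i
    assume i: "i < length ?v" "length ?v \<le> i + \<ell> \<mu>"
    consider "0 < i" "i \<le> n" | "n < i"
      using i len by (cases "i = 0") auto
    then show "?v ! i = \<infinity>"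
    proof cases
      case 2
      then show ?thesis
        using w i nth2[of i] by (simp add: anchor_word_def)
    qed (rule nth1)
  qed
qed

text \<open>Blocks starting inside \<open>w\<close> are merely shifted. A block starting earlier
  would have to fit into the inserted run, because the letters \<open>a\<close> and
  \<open>hd w\<close> on both sides of it are integers; this is possible exactly when
  \<open>n \<ge> \<ell> \<mu>\<close>.\<close>

lemma fault_free_Cons_replicate_append:
  assumes "w \<noteq> []" "hd w \<noteq> \<infinity>" "0 < \<ell> \<mu>"
  shows "fault_free \<mu> d (enat a # replicate n \<infinity> @ w) \<longleftrightarrow>
    fault_free \<mu> d w \<and> a \<in> {1..d} \<and> n < \<ell> \<mu> \<and>
    (\<forall>k\<in>{Suc n..\<ell> \<mu>}. enat (a + \<mu> ! k) \<le> w ! (k - Suc n))"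
proof (cases "anchor_word \<mu> d w")
  case False
  then show ?thesis
    by (simp add: fault_free_def anchor_word_Cons_replicate_append assms)
next
  case w: True
  let ?p = "enat a # replicate n \<infinity>" and ?v = "enat a # replicate n \<infinity> @ w"
  let ?l = "\<ell> \<mu>"
  note len = anchor_word_length[OF w assms(1,2)]
  have shift: "infinity_block ?l ?v (Suc n + j) \<longleftrightarrow> infinity_block ?l w j" for j
    using infinity_block_append[of ?l ?p w j] by simp
  have blocks: "{j. infinity_block ?l ?v j} = {length ?v - ?l} \<longleftrightarrow>
      n < ?l \<and> {j. infinity_block ?l w j} = {length w - ?l}" (is "?A = ?B \<longleftrightarrow> n < ?l \<and> ?C = ?D")
  proof
    assume AB: "?A = ?B"
    have "n < ?l"
    proof (rule ccontr)
      assume "\<not> n < ?l"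
      \<comment> \<open>A run this long gives a block at position 1, whereas the final block starts
        later since \<open>w\<close> is longer than \<open>?l\<close>.\<close>
      then have "infinity_block ?l ?v 1"
        by (auto simp: infinity_block_def nth_append)
      then have "1 = length ?v - ?l"
        using AB by blast
      then show False
        using len by simp
    qed
    moreover have "j \<in> ?C \<longleftrightarrow> j \<in> ?D" for j
    proof -
      have "j \<in> ?C \<longleftrightarrow> Suc n + j \<in> ?A" using shift by simp
      also have "\<dots> \<longleftrightarrow> Suc n + j = length ?v - ?l" using AB by simp
      finally show ?thesis using len by auto
    qed
    ultimately show "n < ?l \<and> ?C = ?D" by blast
  next
    assume R: "n < ?l \<and> ?C = ?D"
    have low: "\<not> infinity_block ?l ?v j" if j: "j \<le> n" for j
    proof (cases "j = 0")
      case True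
      then show ?thesis using assms(3) by (auto simp: infinity_block_def)
    next
      case False
      \<comment> \<open>A block starting at \<open>j\<close> within the run would reach the integer
        \<open>hd w\<close> at position \<open>Suc n\<close>.\<close>
      have "?v ! (j + (Suc n - j)) = hd w"
        using j assms(1) by (simp add: nth_append hd_conv_nth)
      moreover have "Suc n - j < ?l" using False j R by linarith
      ultimately show ?thesis
        using assms(2) unfolding infinity_block_def by metis
    qed
    show "?A = ?B"
    proof (intro set_eqI)
      fix j
      show "j \<in> ?A \<longleftrightarrow> j \<in> ?B"
      proof (cases "j \<le> n")
        case True
        then show ?thesis using low len by auto
      next
        case False
        then obtain i where i: "j = Suc n + i"
          by (metis le_add_diff_inverse not_less_eq_eq)
        have "j \<in> ?A \<longleftrightarrow> i \<in> ?C" using shift i by simp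
        also have "\<dots> \<longleftrightarrow> i = length w - ?l" using R by simp
        finally show ?thesis using i len by auto
      qed
    qed
  qed
  have "fault_free \<mu> d ?v \<longleftrightarrow>
      anchor_word \<mu> d ?v \<and> {j. infinity_block ?l ?v j} = {length ?v - ?l}"
    using len by (simp add: fault_free_def)
  moreover have "fault_free \<mu> d w \<longleftrightarrow> {j. infinity_block ?l w j} = {length w - ?l}"
    using w len assms by (auto simp: fault_free_def)
  ultimately show ?thesis
    unfolding blocks anchor_word_Cons_replicate_append[OF assms(1,2)] using w by blast
qed

text \<open>Base case of the decomposition: the \<infinity>s after the only integer must be exactly
  the final block, since a longer run would contain two blocks.\<close>

lemma fault_free_Cons_replicate:
  assumes "0 < \<ell> \<mu>"
  shows "fault_free \<mu> d (enat a # replicate n \<infinity>) \<longleftrightarrow> a \<in> {1..d} \<and> n = \<ell> \<mu>"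
    (is "fault_free \<mu> d ?v \<longleftrightarrow> _")
proof
  assume v: "fault_free \<mu> d ?v"
  then have anchor: "anchor_word \<mu> d ?v" by (simp add: fault_free_def)
  then have "\<ell> \<mu> \<le> n"
    using anchor_word_length[of \<mu> d ?v] by simp
  moreover have "infinity_block (\<ell> \<mu>) ?v 1"
    using calculation by (simp add: infinity_block_def)
  then have "1 = length ?v - \<ell> \<mu>"
    using v by (auto simp: fault_free_def)
  moreover have "a \<in> {1..d}"
    using anchor by (auto simp: anchor_word_def)
  ultimately show "a \<in> {1..d} \<and> n = \<ell> \<mu>" by simp
next
  assume R: "a \<in> {1..d} \<and> n = \<ell> \<mu>"
  then have "infinity_block (\<ell> \<mu>) ?v j \<longleftrightarrow> j = 1" for j
    using assms by (cases j) (auto simp: infinity_block_def)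
  moreover have "anchor_word \<mu> d ?v"
    using R by (auto simp: anchor_word_def nth_Cons')
  ultimately show "fault_free \<mu> d ?v"
    using R by (simp add: fault_free_def)
qed

section \<open>Gaps between consecutive integers for the two-block partition\<close>

lemma last_index_two_blocks: "\<ell> (replicate r d @ replicate s e) = r + s - 1"
  by (simp add: last_index_def)

text \<open>The bound at distance \<open>Suc n\<close> compares \<open>a\<close> with
  \<open>hd w\<close>. If the part there is \<open>d\<close>, it would force
  \<open>hd w > d\<close>; so it is 1, which gives \<open>r \<le> Suc n\<close> and
  \<open>enat a < hd w\<close>. All further bounds then follow, because later letters within reach
  are at least \<open>hd w\<close>.\<close>

lemma fault_free_two_blocks_step:
  assumes "1 \<le> r" "1 \<le> s" "w \<noteq> []" "hd w \<noteq> \<infinity>"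
  shows "fault_free (replicate r d @ replicate s 1) d (enat a # replicate n \<infinity> @ w) \<longleftrightarrow>
    fault_free (replicate r d @ replicate s 1) d w \<and> 1 \<le> a \<and> enat a < hd w \<and> r \<le> Suc n \<and> Suc n < r + s"
    (is "fault_free ?\<mu> d _ \<longleftrightarrow> _")
proof -
  have l: "\<ell> ?\<mu> = r + s - 1" by (rule last_index_two_blocks)
  have mu: "?\<mu> ! k = (if k < r then d else 1)" if "k \<le> \<ell> ?\<mu>" for k
    using that l assms by (auto simp: nth_append)
  have key: "a \<in> {1..d} \<and> (\<forall>k\<in>{Suc n..\<ell> ?\<mu>}. enat (a + ?\<mu> ! k) \<le> w ! (k - Suc n)) \<longleftrightarrow>
      1 \<le> a \<and> enat a < hd w \<and> r \<le> Suc n"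
    if w: "fault_free ?\<mu> d w" and n: "n < \<ell> ?\<mu>"
  proof -
    obtain b where b: "hd w = enat b" using assms(4) by (cases "hd w") auto
    have w0: "w ! 0 = enat b" using b assms(3) by (simp add: hd_conv_nth)
    have anchor: "anchor_word ?\<mu> d w" using w by (simp add: fault_free_def)
    have "enat b \<in> set w" using b assms(3) by (metis hd_in_set)
    then have bd: "b \<le> d" using anchor by (auto simp: anchor_word_def)
    have mono: "enat (b + ?\<mu> ! k) \<le> w ! k" if "k \<in> {1..\<ell> ?\<mu>}" for k
      using anchor that w0 assms(3) unfolding anchor_word_def
      by (metis add_0 enat.distinct(1) length_greater_0_conv plus_enat_simps(1))
    show ?thesis
    proof
      assume L: "a \<in> {1..d} \<and> (\<forall>k\<in>{Suc n..\<ell> ?\<mu>}. enat (a + ?\<mu> ! k) \<le> w ! (k - Suc n))"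
      then have "enat (a + ?\<mu> ! Suc n) \<le> w ! 0" using n by force
      then have "a + (if Suc n < r then d else 1) \<le> b"
        using mu[of "Suc n"] n w0 by simp
      then show "1 \<le> a \<and> enat a < hd w \<and> r \<le> Suc n"
        using L bd b by (auto split: if_splits)
    next
      assume R: "1 \<le> a \<and> enat a < hd w \<and> r \<le> Suc n"
      have "enat (a + ?\<mu> ! k) \<le> w ! (k - Suc n)" if k: "k \<in> {Suc n..\<ell> ?\<mu>}" for k
      proof -
        \<comment> \<open>Here \<open>r \<le> Suc n \<le> k\<close>, so the part at \<open>k\<close>
          is 1.\<close>
        have "a + ?\<mu> ! k \<le> b" using mu[of k] k R b by auto
        moreover have "enat b \<le> w ! (k - Suc n)"
        proof (cases "k = Suc n")
          case True
          then show ?thesis using w0 by simp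
        next
          case False
          then have "enat (b + ?\<mu> ! (k - Suc n)) \<le> w ! (k - Suc n)"
            using k by (intro mono) auto
          then show ?thesis by (metis enat_ord_simps(1) le_add1 order_trans)
        qed
        ultimately show ?thesis by (metis enat_ord_simps(1) order_trans)
      qed
      then show "a \<in> {1..d} \<and> (\<forall>k\<in>{Suc n..\<ell> ?\<mu>}. enat (a + ?\<mu> ! k) \<le> w ! (k - Suc n))"
        using R bd b by auto
    qed
  qed
  have pos: "0 < \<ell> ?\<mu>" and lt: "n < \<ell> ?\<mu> \<longleftrightarrow> Suc n < r + s"
    using l assms(1,2) by linarith+
  show ?thesis
    unfolding fault_free_Cons_replicate_append[OF assms(3,4) pos]
    using key lt by blast
qed

section \<open>Monomials of words\<close>

definition weight :: "enat list \<Rightarrow> rat fps fps" where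
  "weight w = var_x ^ width w * var_t ^ bigtiles w"

lemma weight_append: "weight (v @ w) = weight v * weight w"
  by (simp add: weight_def width_def bigtiles_def power_add mult_ac)

lemma weight_Cons_replicate: "weight (enat a # replicate n \<infinity>) = var_t * var_x ^ Suc n"
  by (simp add: weight_def width_def bigtiles_def mult_ac)

text \<open>Turns the width-by-width definition into one finite sum of multiplicative weights, to
  which decompositions of words apply directly.\<close>

lemma fault_free_gf_eq_sum:
  assumes "finite {w. fault_free \<mu> d w}"
  shows "fault_free_gf \<mu> d = (\<Sum>w | fault_free \<mu> d w. weight w)"
proof (rule fps_ext)
  fix n
  have "fps_nth (weight w) n = (if width w = n then fps_X ^ bigtiles w else 0)" for w
    by (simp add: weight_def fps_const_power fps_X_power_mult_nth)
  then have "fps_nth (\<Sum>w | fault_free \<mu> d w. weight w) n =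
      (\<Sum>w | fault_free \<mu> d w. if width w = n then fps_X ^ bigtiles w else 0)"
    by (simp add: fps_sum_nth)
  also have "\<dots> = (\<Sum>w | fault_free \<mu> d w \<and> width w = n. fps_X ^ bigtiles w)"
    using assms by (simp add: sum.inter_filter[symmetric])
  finally show "fps_nth (fault_free_gf \<mu> d) n = fps_nth (\<Sum>w | fault_free \<mu> d w. weight w) n"
    by (simp add: fault_free_gf_def)
qed

section \<open>Recursion on a lower bound for the first letter\<close>

text \<open>The clause \<open>hd w \<noteq> \<infinity>\<close> excludes the word
  \<open>[\<infinity>]\<close>, whose head also exceeds every \<open>enat c\<close>.\<close>

definition words_above :: "nat \<Rightarrow> nat \<Rightarrow> nat \<Rightarrow> nat \<Rightarrow> enat list set" where
  "words_above r s d c = {w. fault_free (replicate r d @ replicate s 1) d w \<and>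
     hd w \<noteq> \<infinity> \<and> enat c < hd w}"

lemma words_above_top: "words_above r s d d = {}"
proof -
  have False if w: "w \<in> words_above r s d d" for w
  proof -
    have ff: "fault_free (replicate r d @ replicate s 1) d w" and h: "hd w \<noteq> \<infinity>" "enat d < hd w"
      using w by (auto simp: words_above_def)
    then have "w \<noteq> []" "set w \<subseteq> insert \<infinity> (enat ` {1..d})"
      by (auto simp: fault_free_def anchor_word_def)
    then have "hd w \<in> insert \<infinity> (enat ` {1..d})" using hd_in_set by blast
    then show False using h by auto
  qed
  then show ?thesis by blast
qed

text \<open>The new words begin with \<open>Suc a\<close>. Such a word either has no further integer
  or is cut at its next integer, which is larger; the gap \<open>Suc n\<close> between the two lies
  in \<open>{r..<r + s}\<close>.\<close>

lemma words_above_step: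
  assumes "1 \<le> r" "1 \<le> s" "a < d"
  shows "words_above r s d a = words_above r s d (Suc a) \<union>
    insert (enat (Suc a) # replicate (r + s - 1) \<infinity>)
      ((\<lambda>(n, w). enat (Suc a) # replicate n \<infinity> @ w) ` ({r - 1..<r + s - 1} \<times> words_above r s d (Suc a)))"
    (is "?L = ?M \<union> insert ?e ?N")
proof (intro equalityI subsetI)
  let ?\<mu> = "replicate r d @ replicate s 1"
  have pos: "0 < \<ell> ?\<mu>" using assms by (simp add: last_index_def)
  fix w
  assume w: "w \<in> ?L"
  then have ff: "fault_free ?\<mu> d w" and h: "hd w \<noteq> \<infinity>" "enat a < hd w"
    by (auto simp: words_above_def)
  from ff h obtain b v where bv: "w = enat b # v"
    by (cases w) (auto simp: fault_free_def)
  show "w \<in> ?M \<union> insert ?e ?N"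
  proof (cases "b = Suc a")
    case False
    then show ?thesis using w bv by (auto simp: words_above_def)
  next
    case b: True
    \<comment> \<open>\<open>n\<close> counts the \<infinity>s directly after the first letter;
      \<open>u\<close> is what starts at the next integer, empty if there is none.\<close>
    define n where "n = length (takeWhile (\<lambda>x. x = \<infinity>) v)"
    define u where "u = dropWhile (\<lambda>x. x = \<infinity>) v"
    have "takeWhile (\<lambda>x. x = \<infinity>) v = replicate n \<infinity>"
      unfolding n_def by (intro replicate_eqI) (auto dest: set_takeWhileD)
    then have v: "v = replicate n \<infinity> @ u"
      unfolding u_def using takeWhile_dropWhile_id[of "\<lambda>x. x = \<infinity>" v] by simp
    show ?thesis
    proof (cases "u = []")
      case True
      then have "n = \<ell> ?\<mu>"
        using fault_free_Cons_replicate[OF pos] ff bv v by auto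
      then show ?thesis using True bv b v by (simp add: last_index_def)
    next
      case False
      then have "hd u \<noteq> \<infinity>" unfolding u_def using hd_dropWhile by blast
      then have "fault_free ?\<mu> d u" "enat b < hd u" "r \<le> Suc n" "Suc n < r + s"
        using ff fault_free_two_blocks_step[OF assms(1,2) False] bv v by auto
      then have "(n, u) \<in> {r - 1..<r + s - 1} \<times> ?M"
        using b \<open>hd u \<noteq> \<infinity>\<close> by (auto simp: words_above_def)
      then show ?thesis using bv b v by force
    qed
  qed
next
  let ?\<mu> = "replicate r d @ replicate s 1"
  have pos: "0 < \<ell> ?\<mu>" using assms by (simp add: last_index_def)
  fix w
  assume "w \<in> ?M \<union> insert ?e ?N"
  then consider "w \<in> ?M" | "w = ?e"
    | n u where "w = enat (Suc a) # replicate n \<infinity> @ u" "r - 1 \<le> n" "n < r + s - 1" "u \<in> ?M"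
    by auto
  then show "w \<in> ?L"
  proof cases
    case 1
    then show ?thesis
      by (auto simp: words_above_def intro: less_trans[of "enat a" "enat (Suc a)"])
  next
    case 2
    then show ?thesis
      using fault_free_Cons_replicate[OF pos, of d "Suc a" "r + s - 1"] assms
      by (simp add: words_above_def last_index_def)
  next
    case 3
    then have u: "fault_free ?\<mu> d u" "hd u \<noteq> \<infinity>" "enat (Suc a) < hd u"
      by (auto simp: words_above_def)
    then have "u \<noteq> []" by (auto simp: fault_free_def)
    then show ?thesis
      using 3 u fault_free_two_blocks_step[OF assms(1,2) \<open>u \<noteq> []\<close> u(2), of d "Suc a" n] assms
      by (auto simp: words_above_def)
  qed
qed

text \<open>Since \<open>w\<close> starts with an integer, \<open>n\<close> is recovered as the
  length of the maximal run of \<infinity>s after the first letter.\<close>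

lemma inj_on_prepend:
  assumes "\<And>w. w \<in> A \<Longrightarrow> w \<noteq> [] \<and> hd w \<noteq> \<infinity>"
  shows "inj_on (\<lambda>(n, w). enat a # replicate n \<infinity> @ w) (I \<times> A)"
proof (rule inj_onI, clarify)
  fix n v m w
  assume vw: "v \<in> A" "w \<in> A" and eq: "replicate n \<infinity> @ v = replicate m \<infinity> @ w"
  have tw: "length (takeWhile (\<lambda>x. x = \<infinity>) (replicate k \<infinity> @ u)) = k" if "u \<in> A" for k u
  proof -
    have "takeWhile (\<lambda>x. x = \<infinity>) u = []" using assms[OF that] by (cases u) auto
    then show ?thesis by (induction k) auto
  qed
  have "n = m" using tw[OF vw(1), of n] tw[OF vw(2), of m] eq by simp
  then show "n = m \<and> v = w" using eq by simp
qed

text \<open>Induction on \<open>k\<close>, the number of integers above the bound. Multiplying by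
  the sum of powers and adding \<open>var_x ^ s\<close> makes the affine recursion geometric and
  avoids division. For \<open>k = 0\<close> there are no words and both sides are
  \<open>var_x ^ s\<close>.\<close>

lemma words_above_gf:
  assumes "1 \<le> r" "1 \<le> s" "k \<le> d"
  shows "finite (words_above r s d (d - k)) \<and>
    (\<Sum>w\<in>words_above r s d (d - k). weight w) * (\<Sum>i<s. var_x ^ i) + var_x ^ s =
    var_x ^ s * (1 + var_t * var_x ^ r * (\<Sum>i<s. var_x ^ i)) ^ k"
  using assms(3)
proof (induction k)
  case 0
  then show ?case by (simp add: words_above_top)
next
  case (Suc k)
  define a where "a = d - Suc k"
  have a: "a < d" "d - k = Suc a" using Suc.prems by (auto simp: a_def)
  let ?A = "words_above r s d (Suc a)" and ?e = "enat (Suc a) # replicate (r + s - 1) \<infinity>"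
  let ?f = "\<lambda>(n, w). enat (Suc a) # replicate n \<infinity> @ w"
  let ?N = "?f ` ({r - 1..<r + s - 1} \<times> ?A)"
  let ?S = "\<Sum>i<s. var_x ^ i" and ?W = "\<Sum>w\<in>?A. weight w"
  have fin: "finite ?A"
    and IH: "?W * ?S + var_x ^ s = var_x ^ s * (1 + var_t * var_x ^ r * ?S) ^ k"
    using Suc a by auto
  have A: "w \<noteq> [] \<and> hd w \<noteq> \<infinity> \<and> hd w \<noteq> enat (Suc a)" if "w \<in> ?A" for w
    using that by (auto simp: words_above_def fault_free_def)
  note step = words_above_step[OF assms(1,2) a(1)]
  have finN: "finite ?N" using fin by blast
  have disj: "?A \<inter> insert ?e ?N = {}" using A by fastforce
  \<comment> \<open>Words in \<open>?N\<close> contain a second integer, \<open>?e\<close> does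
    not.\<close>
  have e: "?e \<notin> ?N"
  proof
    assume "?e \<in> ?N"
    then obtain n w where w: "w \<in> ?A" "replicate (r + s - 1) \<infinity> = replicate n \<infinity> @ w" by auto
    have "hd w \<in> set (replicate (r + s - 1) \<infinity>)" using w A by simp
    then show False using A[OF w(1)] by simp
  qed
  have "(\<Sum>w\<in>?N. weight w) = (\<Sum>(n, w)\<in>{r - 1..<r + s - 1} \<times> ?A. weight (enat (Suc a) # replicate n \<infinity> @ w))"
    using A by (subst sum.reindex[OF inj_on_prepend]) (auto simp: case_prod_unfold)
  also have "\<dots> = (\<Sum>(n, w)\<in>{r - 1..<r + s - 1} \<times> ?A. (var_t * var_x ^ Suc n) * weight w)"
  proof -
    have "weight (enat (Suc a) # replicate n \<infinity> @ w) = (var_t * var_x ^ Suc n) * weight w" for n w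
      using weight_append[of "enat (Suc a) # replicate n \<infinity>" w] weight_Cons_replicate[of "Suc a" n]
      by simp
    then show ?thesis by simp
  qed
  also have "\<dots> = (\<Sum>n\<in>{r - 1..<r + s - 1}. var_t * var_x ^ Suc n) * ?W"
    by (simp only: sum_product sum.cartesian_product)
  \<comment> \<open>Substitution \<open>n = r - 1 + i\<close>; here \<open>r \<ge> 1\<close> makes
    \<open>Suc n = r + i\<close>.\<close>
  also have "(\<Sum>n\<in>{r - 1..<r + s - 1}. var_t * var_x ^ Suc n) = (\<Sum>i<s. var_t * var_x ^ (r + i))"
    using assms(1,2) by (intro sum.reindex_bij_witness[of _ "\<lambda>i. r - 1 + i" "\<lambda>n. n - (r - 1)"]) auto
  also have "\<dots> = var_t * var_x ^ r * ?S"
    by (simp add: power_add sum_distrib_left mult.assoc)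
  finally have N: "(\<Sum>w\<in>?N. weight w) = var_t * var_x ^ r * ?S * ?W" .
  have We: "weight ?e = var_t * var_x ^ r * var_x ^ s"
    using weight_Cons_replicate[of "Suc a" "r + s - 1"] assms by (simp add: power_add mult.assoc)
  have "(\<Sum>w\<in>words_above r s d a. weight w) = ?W + (weight ?e + (\<Sum>w\<in>?N. weight w))"
    unfolding step using fin finN disj e by (subst sum.union_disjoint) auto
  \<comment> \<open>The single word \<open>?e\<close> contributes precisely the cross term
    \<open>var_t * var_x ^ r * ?S * var_x ^ s\<close>.\<close>
  also have "\<dots> * ?S + var_x ^ s = (1 + var_t * var_x ^ r * ?S) * (?W * ?S + var_x ^ s)"
    unfolding N We by (simp add: algebra_simps)
  also have "\<dots> = var_x ^ s * (1 + var_t * var_x ^ r * ?S) ^ Suc k"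
    unfolding IH by (simp add: mult_ac)
  finally show ?case
    using step fin finN unfolding a_def by simp
qed

section \<open>The closed form, read off at bound 0\<close>

theorem theorem4p29:
  fixes d r s :: nat
  assumes "d \<ge> 1" and "r \<ge> 1" and "s \<ge> 1"
  shows "fault_free_gf (replicate r d @ replicate s 1) d =
    var_x + var_x ^ s *
      (((1 + var_t * var_x ^ r * (\<Sum>i<s. var_x ^ i)) ^ d - 1) / (\<Sum>i<s. var_x ^ i))"
proof -
  let ?\<mu> = "replicate r d @ replicate s 1"
  let ?S = "\<Sum>i<s. var_x ^ i" and ?A = "words_above r s d 0"
  let ?P = "(1 + var_t * var_x ^ r * ?S) ^ d - 1"
  have fin: "finite ?A" and gf: "(\<Sum>w\<in>?A. weight w) * ?S + var_x ^ s = var_x ^ s * (?P + 1)"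
    using words_above_gf[OF assms(2,3), of d d] by auto
  \<comment> \<open>As \<open>s \<ge> 1\<close>, the term \<open>i = 0\<close> is present, so
    \<open>?S\<close> is a unit and the quotient by it is genuine.\<close>
  have S0: "fps_nth ?S 0 = 1"
    using assms(3) by (simp add: fps_sum_nth fps_X_power_nth if_distrib sum.delta cong: if_cong)
  then have "?S \<noteq> 0" by auto
  have inf: "fault_free ?\<mu> d [\<infinity>]"
    by (auto simp: fault_free_def anchor_word_def)
  \<comment> \<open>Integer letters start at 1, so the bound 0 loses no word and only
    \<open>[\<infinity>]\<close> lies outside \<open>?A\<close>.\<close>
  have hd_pos: "enat 0 < hd w" if "anchor_word ?\<mu> d w" "w \<noteq> []" for w
  proof -
    have "hd w \<in> insert \<infinity> (enat ` {1..d})"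
      using that hd_in_set[of w] unfolding anchor_word_def by blast
    then show ?thesis by auto
  qed
  have words: "{w. fault_free ?\<mu> d w} = insert [\<infinity>] ?A"
    using inf hd_pos unfolding words_above_def fault_free_def by auto
  have "[\<infinity>] \<notin> ?A" by (simp add: words_above_def)
  then have B: "fault_free_gf ?\<mu> d = weight [\<infinity>] + (\<Sum>w\<in>?A. weight w)"
    using fault_free_gf_eq_sum[of ?\<mu> d] fin words by simp
  have "(\<Sum>w\<in>?A. weight w) * ?S = var_x ^ s * ?P"
    using gf by (simp add: algebra_simps)
  also have "\<dots> = var_x ^ s * (?P / ?S) * ?S"
    using divide_mult_cancel_unit[OF S0, of ?P] by (simp only: mult.assoc)
  \<comment> \<open>The nonzero factor \<open>?S\<close> cancels in the integral domain of power
    series.\<close>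
  finally have "(\<Sum>w\<in>?A. weight w) = var_x ^ s * (?P / ?S)"
    using \<open>?S \<noteq> 0\<close> by simp
  moreover have "weight [\<infinity>] = var_x"
    by (simp add: weight_def width_def bigtiles_def)
  ultimately show ?thesis using B by simp
qed

end
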